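(* Let $n\in\{6,7,8\}$. The elliptic Artin group $\mathrm{Art}(\tilde{E}_n^{(1,1)})$ is isomorphic to the group $G'(\tilde{E}_n^{(1,1)})$ defined by the presentation with generators $t_i$ ($i\in\mathbb{Z}$), $s_1,\dots,s_n$ and relations: (1) $t_is_jt_i=s_jt_is_j$ for $i\in\mathbb{Z}$ and $j=1,2,3$; (2) $t_is_j=s_jt_i$ for $i\in\mathbb{Z}$ and $4\le j\le n$; (3) $t_it_{i-1}=t_jt_{j-1}$ for $i,j\in\mathbb{Z}$; (4) for $1\le j<k\le n$: $s_js_ks_j=s_ks_js_k$ if $\{j,k\}\in E_n$, and $s_js_k=s_ks_j$ if $\{j,k\}\notin E_n$, where $E_6=\{\{1,4\},\{2,5\},\{3,6\}\}$, $E_7=\{\{2,4\},\{4,5\},\{3,6\},\{6,7\}\}$ and $E_8=\{\{2,4\},\{3,5\},\{5,6\},\{6,7\},\{7,8\}\}$. Moreover, adding to this presentation the quadratic relations $t_i^2=1$ ($i\in\mathbb{Z}$) and $s_j^2=1$ ($1\le j\le n$) gives a presentation of the group $\mathrm{Hyp}(\tilde{E}_n^{(1,1)})$.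
   Context: Let $n\in\{6,7,8\}$ and let $E_6=\{\{1,4\},\{2,5\},\{3,6\}\}$, $E_7=\{\{2,4\},\{4,5\},\{3,6\},\{6,7\}\}$, $E_8=\{\{2,4\},\{3,5\},\{5,6\},\{6,7\},\{7,8\}\}$ (the edges among $s_1,\dots,s_n$ in the elliptic Dynkin diagram). The elliptic Artin group $\mathrm{Art}(\tilde{E}_n^{(1,1)})$ is taken to be the group $G(\tilde{E}_n^{(1,1)})$ given by the (usual, known) presentation with generators $t_0,t_1,s_1,\dots,s_n$ and relations: (P1) $t_is_jt_i=s_jt_is_j$ for $i=0,1$ and $j=1,2,3$; (P2) $t_is_j=s_jt_i$ for $i=0,1$ and $4\le j\le n$; (P3) $s_jt_1t_0s_jt_1t_0=t_1t_0s_jt_1t_0s_j$ for $j=1,2,3$; (P4) for $1\le j<k\le n$: $s_js_ks_j=s_ks_js_k$ if $\{j,k\}\in E_n$, and $s_js_k=s_ks_j$ if $\{j,k\}\notin E_n$. The hyperbolic elliptic Weyl group $\mathrm{Hyp}(\tilde{E}_n^{(1,1)})$ is the group presented by these generators and relations (P1)-(P4) together with $t_0^2=t_1^2=1$ and $s_j^2=1$ for $1\le j\le n$. *)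

theory Defs
  imports "HOL-Algebra.Group"
begin

section \<open>Groups given by generators and relations\<close>

text \<open>A group word over an alphabet is a list of letters; \<open>(x, True)\<close> stands for the generator
  \<open>x\<close> and \<open>(x, False)\<close> for its formal inverse.\<close>

type_synonym 'a gword = "('a \<times> bool) list"

definition gwords :: "'a set \<Rightarrow> 'a gword set" where
  "gwords X = lists (X \<times> UNIV)"

definition inv_gword :: "'a gword \<Rightarrow> 'a gword" where
  "inv_gword w = rev (map (\<lambda>(x, b). (x, \<not> b)) w)"

text \<open>The congruence on words over \<open>X\<close> generated by free cancellation and by the relations
  \<open>l = r\<close> for \<open>(l, r) \<in> R\<close>. Only words over \<open>X\<close> take part: a pair in \<open>R\<close> that mentions a letter
  outside \<open>X\<close> would have no effect.\<close>

inductive pres_eq :: "'a set \<Rightarrow> ('a gword \<times> 'a gword) set \<Rightarrow> 'a gword \<Rightarrow> 'a gword \<Rightarrow> bool"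
  for X :: "'a set" and R :: "('a gword \<times> 'a gword) set" where
  refl: "u \<in> gwords X \<Longrightarrow> pres_eq X R u u"
| sym: "pres_eq X R u v \<Longrightarrow> pres_eq X R v u"
| trans: "pres_eq X R u v \<Longrightarrow> pres_eq X R v w \<Longrightarrow> pres_eq X R u w"
| cancel: "u \<in> gwords X \<Longrightarrow> v \<in> gwords X \<Longrightarrow> x \<in> X \<Longrightarrow>
    pres_eq X R (u @ [(x, b), (x, \<not> b)] @ v) (u @ v)"
| relation: "u \<in> gwords X \<Longrightarrow> v \<in> gwords X \<Longrightarrow> (l, r) \<in> R \<Longrightarrow> l \<in> gwords X \<Longrightarrow> r \<in> gwords X \<Longrightarrow>
    pres_eq X R (u @ l @ v) (u @ r @ v)"

definition pres_class :: "'a set \<Rightarrow> ('a gword \<times> 'a gword) set \<Rightarrow> 'a gword \<Rightarrow> 'a gword set" where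
  "pres_class X R u = {v. pres_eq X R u v}"

definition presented_group ::
    "'a set \<Rightarrow> ('a gword \<times> 'a gword) set \<Rightarrow> 'a gword set monoid" where
  "presented_group X R =
    \<lparr>carrier = pres_class X R ` gwords X,
     monoid.mult = (\<lambda>A B. \<Union>u\<in>A. \<Union>v\<in>B. pres_class X R (u @ v)),
     one = pres_class X R []\<rparr>"

lemma gwords_Nil [simp]: "[] \<in> gwords X"
  and gwords_append [simp]: "u @ v \<in> gwords X \<longleftrightarrow> u \<in> gwords X \<and> v \<in> gwords X"
  and gwords_Cons [simp]: "a # u \<in> gwords X \<longleftrightarrow> fst a \<in> X \<and> u \<in> gwords X"
  by (auto simp: gwords_def mem_Times_iff)

lemma inv_gword_in_gwords: "u \<in> gwords X \<Longrightarrow> inv_gword u \<in> gwords X"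
  by (auto simp: gwords_def inv_gword_def in_lists_conv_set)

lemma pres_eq_in_gwords: "pres_eq X R u v \<Longrightarrow> u \<in> gwords X \<and> v \<in> gwords X"
  by (induction rule: pres_eq.induct) auto

lemma pres_eq_context:
  assumes "pres_eq X R u v" "p \<in> gwords X" "q \<in> gwords X"
  shows "pres_eq X R (p @ u @ q) (p @ v @ q)"
  using assms
proof (induction rule: pres_eq.induct)
  case (cancel u v x b)
  then show ?case
    using pres_eq.cancel[of "p @ u" X "v @ q" x R b] by simp
next
  case (relation u v l r)
  then show ?case
    using pres_eq.relation[of "p @ u" X "v @ q" l r R] by simp
next
  case (trans u v w)
  then show ?case by (blast intro: pres_eq.trans)
next
  case (sym u v)
  then show ?case by (blast intro: pres_eq.sym)
next
  case (refl u)
  then show ?case by (simp add: pres_eq.refl)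
qed

lemma pres_eq_append:
  assumes "pres_eq X R u u'" "pres_eq X R v v'"
  shows "pres_eq X R (u @ v) (u' @ v')"
proof -
  have "pres_eq X R (u @ v) (u' @ v)"
    using pres_eq_context[OF assms(1), of "[]" v] pres_eq_in_gwords[OF assms(2)] by simp
  moreover have "pres_eq X R (u' @ v) (u' @ v')"
    using pres_eq_context[OF assms(2), of u' "[]"] pres_eq_in_gwords[OF assms(1)] by simp
  ultimately show ?thesis
    by (rule pres_eq.trans)
qed

lemma pres_eq_inverse:
  "u \<in> gwords X \<Longrightarrow> pres_eq X R (inv_gword u @ u) []"
proof (induction u)
  case Nil
  then show ?case by (simp add: inv_gword_def pres_eq.refl)
next
  case (Cons a u)
  obtain x b where a: "a = (x, b)" by (cases a)
  have "pres_eq X R (inv_gword u @ [(x, \<not> b), (x, \<not> \<not> b)] @ u) (inv_gword u @ u)"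
    using Cons.prems a by (intro pres_eq.cancel) (auto intro: inv_gword_in_gwords)
  moreover have "pres_eq X R (inv_gword u @ u) []"
    using Cons by simp
  ultimately have "pres_eq X R (inv_gword u @ [(x, \<not> b), (x, \<not> \<not> b)] @ u) []"
    by (rule pres_eq.trans)
  then show ?case
    using a by (simp add: inv_gword_def)
qed

lemma pres_class_eq_iff:
  "u \<in> gwords X \<Longrightarrow> pres_class X R u = pres_class X R v \<longleftrightarrow> pres_eq X R u v"
  unfolding pres_class_def set_eq_iff mem_Collect_eq
  by (metis pres_eq.refl pres_eq.sym pres_eq.trans pres_eq_in_gwords)

lemma presented_group_mult:
  assumes "u \<in> gwords X" "v \<in> gwords X"
  shows "pres_class X R u \<otimes>\<^bsub>presented_group X R\<^esub> pres_class X R v = pres_class X R (u @ v)"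
proof -
  have "pres_class X R (u' @ v') = pres_class X R (u @ v)"
    if "u' \<in> pres_class X R u" "v' \<in> pres_class X R v" for u' v'
  proof -
    have "pres_eq X R (u @ v) (u' @ v')"
      using that by (intro pres_eq_append) (simp_all add: pres_class_def)
    then show ?thesis
      using assms pres_class_eq_iff[of "u @ v" X R "u' @ v'"] by simp
  qed
  moreover have "u \<in> pres_class X R u" "v \<in> pres_class X R v"
    using assms by (auto simp: pres_class_def intro: pres_eq.refl)
  ultimately have "(\<Union>u'\<in>pres_class X R u. \<Union>v'\<in>pres_class X R v. pres_class X R (u' @ v'))
      = pres_class X R (u @ v)"
    by blast
  then show ?thesis
    by (simp add: presented_group_def)
qed

lemma group_presented_group: "group (presented_group X R)"
proof (rule groupI)
  fix a assume "a \<in> carrier (presented_group X R)"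
  then obtain u where u: "u \<in> gwords X" "a = pres_class X R u"
    by (auto simp: presented_group_def)
  have "pres_class X R (inv_gword u) \<otimes>\<^bsub>presented_group X R\<^esub> a = pres_class X R (inv_gword u @ u)"
    using u by (simp add: presented_group_mult inv_gword_in_gwords)
  also have "\<dots> = \<one>\<^bsub>presented_group X R\<^esub>"
    using u pres_eq_inverse
    by (simp add: presented_group_def pres_class_eq_iff inv_gword_in_gwords)
  finally show "\<exists>b\<in>carrier (presented_group X R).
      b \<otimes>\<^bsub>presented_group X R\<^esub> a = \<one>\<^bsub>presented_group X R\<^esub>"
    by (rule bexI) (use u in \<open>simp add: presented_group_def inv_gword_in_gwords\<close>)
next
  fix a assume "a \<in> carrier (presented_group X R)"
  then obtain u where u: "u \<in> gwords X" "a = pres_class X R u"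
    by (auto simp: presented_group_def)
  have "\<one>\<^bsub>presented_group X R\<^esub> = pres_class X R []"
    by (simp add: presented_group_def)
  then show "\<one>\<^bsub>presented_group X R\<^esub> \<otimes>\<^bsub>presented_group X R\<^esub> a = a"
    using u by (simp add: presented_group_mult)
next
  have carrier: "carrier (presented_group X R) = pres_class X R ` gwords X"
    by (simp add: presented_group_def)
  show "\<one>\<^bsub>presented_group X R\<^esub> \<in> carrier (presented_group X R)"
    by (simp add: presented_group_def)
  fix a b assume ab: "a \<in> carrier (presented_group X R)" "b \<in> carrier (presented_group X R)"
  then show "a \<otimes>\<^bsub>presented_group X R\<^esub> b \<in> carrier (presented_group X R)"
    unfolding carrier by (auto simp: presented_group_mult)
  fix c assume "c \<in> carrier (presented_group X R)"
  with ab show "a \<otimes>\<^bsub>presented_group X R\<^esub> b \<otimes>\<^bsub>presented_group X R\<^esub> c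
      = a \<otimes>\<^bsub>presented_group X R\<^esub> (b \<otimes>\<^bsub>presented_group X R\<^esub> c)"
    unfolding carrier by (auto simp: presented_group_mult)
qed


section \<open>Elliptic Artin groups and hyperbolic elliptic Weyl groups of types \<open>E\<^sub>6, E\<^sub>7, E\<^sub>8\<close>\<close>

text \<open>\<open>T i\<close> is the letter \<open>t\<^sub>i\<close> and \<open>S j\<close> the letter \<open>s\<^sub>j\<close>; which letters actually are generators
  is fixed by the generating sets below.\<close>

datatype gen = T int | S nat

definition pos_word :: "'a list \<Rightarrow> 'a gword" where
  "pos_word xs = map (\<lambda>x. (x, True)) xs"

definition braid :: "'a \<Rightarrow> 'a \<Rightarrow> 'a gword \<times> 'a gword" where
  "braid x y = (pos_word [x, y, x], pos_word [y, x, y])"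

definition commute :: "'a \<Rightarrow> 'a \<Rightarrow> 'a gword \<times> 'a gword" where
  "commute x y = (pos_word [x, y], pos_word [y, x])"

definition quadratic :: "'a \<Rightarrow> 'a gword \<times> 'a gword" where
  "quadratic x = (pos_word [x, x], [])"

text \<open>Only the values at \<open>6\<close>, \<open>7\<close>, \<open>8\<close> are meaningful.\<close>

definition edges :: "nat \<Rightarrow> nat set set" where
  "edges n =
    (if n = 6 then {{1, 4}, {2, 5}, {3, 6}}
     else if n = 7 then {{2, 4}, {4, 5}, {3, 6}, {6, 7}}
     else if n = 8 then {{2, 4}, {3, 5}, {5, 6}, {6, 7}, {7, 8}}
     else {})"

definition S_relations :: "nat \<Rightarrow> (gen gword \<times> gen gword) set" where
  "S_relations n =
    {braid (S j) (S k) | j k. 1 \<le> j \<and> j < k \<and> k \<le> n \<and> {j, k} \<in> edges n} \<union>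
    {commute (S j) (S k) | j k. 1 \<le> j \<and> j < k \<and> k \<le> n \<and> {j, k} \<notin> edges n}"

definition TS_relations :: "nat \<Rightarrow> int set \<Rightarrow> (gen gword \<times> gen gword) set" where
  "TS_relations n I =
    {braid (T i) (S j) | i j. i \<in> I \<and> j \<in> {1, 2, 3}} \<union>
    {commute (T i) (S j) | i j. i \<in> I \<and> 4 \<le> j \<and> j \<le> n}"

definition generators :: "nat \<Rightarrow> int set \<Rightarrow> gen set" where
  "generators n I = T ` I \<union> S ` {1..n}"

definition quadratic_relations :: "nat \<Rightarrow> int set \<Rightarrow> (gen gword \<times> gen gword) set" where
  "quadratic_relations n I = quadratic ` generators n I"

definition elliptic_relations :: "nat \<Rightarrow> (gen gword \<times> gen gword) set" where
  "elliptic_relations n =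
    TS_relations n {0, 1} \<union>
    {(pos_word [S j, T 1, T 0, S j, T 1, T 0], pos_word [T 1, T 0, S j, T 1, T 0, S j]) | j.
      j \<in> {1, 2, 3}} \<union>
    S_relations n"

definition elliptic_Artin :: "nat \<Rightarrow> gen gword set monoid" where
  "elliptic_Artin n = presented_group (generators n {0, 1}) (elliptic_relations n)"

definition hyperbolic_elliptic_Weyl :: "nat \<Rightarrow> gen gword set monoid" where
  "hyperbolic_elliptic_Weyl n =
    presented_group (generators n {0, 1}) (elliptic_relations n \<union> quadratic_relations n {0, 1})"

definition elliptic_relations' :: "nat \<Rightarrow> (gen gword \<times> gen gword) set" where
  "elliptic_relations' n =
    TS_relations n UNIV \<union>
    {(pos_word [T i, T (i - 1)], pos_word [T j, T (j - 1)]) | i j. True} \<union>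
    S_relations n"

definition elliptic_Artin' :: "nat \<Rightarrow> gen gword set monoid" where
  "elliptic_Artin' n = presented_group (generators n UNIV) (elliptic_relations' n)"

end

theory Submission
  imports Defs
begin

text \<open>Write \<open>c = t\<^sub>1 t\<^sub>0\<close>. Relation (3) says that \<open>t\<^sub>i t\<^sub>i\<^sub>-\<^sub>1 = c\<close> for all \<open>i\<close>, so the
  \<open>t\<^sub>i\<close> are determined by \<open>t\<^sub>0, t\<^sub>1\<close>, and conversely
  \<open>t\<^sub>2\<^sub>k = c\<^sup>k t\<^sub>0 c\<^sup>-\<^sup>k\<close>, \<open>t\<^sub>2\<^sub>k\<^sub>+\<^sub>1 = c\<^sup>k t\<^sub>1 c\<^sup>-\<^sup>k\<close> solves (3). If \<open>t\<^sub>i\<close> braids with \<open>s\<close>, then any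
  two of the following imply the third: \<open>t\<^sub>i\<^sub>+\<^sub>1\<close> braids with \<open>s\<close>, \<open>t\<^sub>i\<^sub>-\<^sub>1\<close> braids with \<open>s\<close>, and
  \<open>s c s c = c s c s\<close>. Hence (P3) propagates the braid relations from \<open>t\<^sub>0, t\<^sub>1\<close> to all \<open>t\<^sub>i\<close>
  and follows from them. The remaining relations propagate because \<open>t\<^sub>i\<^sub>+\<^sub>1 = t\<^sub>i t\<^sub>i\<^sub>-\<^sub>1 t\<^sub>i\<^sup>-\<^sup>1\<close>.\<close>

section \<open>Homomorphisms out of presented groups\<close>

definition eval_word :: "('g, 'm) monoid_scheme \<Rightarrow> ('a \<Rightarrow> 'g) \<Rightarrow> 'a gword \<Rightarrow> 'g" where
  "eval_word G f w =
    foldr (\<lambda>(x, b) g. (if b then f x else inv\<^bsub>G\<^esub> f x) \<otimes>\<^bsub>G\<^esub> g) w \<one>\<^bsub>G\<^esub>"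

lemma eval_word_Nil [simp]: "eval_word G f [] = \<one>\<^bsub>G\<^esub>"
  and eval_word_Cons [simp]:
    "eval_word G f ((x, b) # w) = (if b then f x else inv\<^bsub>G\<^esub> f x) \<otimes>\<^bsub>G\<^esub> eval_word G f w"
  by (simp_all add: eval_word_def)

definition satisfies :: "('g, 'm) monoid_scheme \<Rightarrow> ('a \<Rightarrow> 'g) \<Rightarrow> ('a gword \<times> 'a gword) set \<Rightarrow> bool"
  where "satisfies G f R \<longleftrightarrow> (\<forall>(l, r)\<in>R. eval_word G f l = eval_word G f r)"

lemma satisfies_Un [simp]: "satisfies G f (R \<union> Q) \<longleftrightarrow> satisfies G f R \<and> satisfies G f Q"
  by (auto simp: satisfies_def)

lemma (in group) eval_word_closed:
  "f \<in> X \<rightarrow> carrier G \<Longrightarrow> w \<in> gwords X \<Longrightarrow> eval_word G f w \<in> carrier G"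
  by (induction w) (auto simp: Pi_iff)

lemma (in group) eval_word_append:
  "f \<in> X \<rightarrow> carrier G \<Longrightarrow> u \<in> gwords X \<Longrightarrow> v \<in> gwords X \<Longrightarrow>
    eval_word G f (u @ v) = eval_word G f u \<otimes> eval_word G f v"
proof (induction u)
  case Nil
  then show ?case by (simp add: eval_word_closed)
next
  case (Cons a u)
  then show ?case
    by (cases a) (auto simp: m_assoc Pi_iff eval_word_closed[of f X])
qed

text \<open>This is the well-definedness behind von Dyck's theorem: free cancellation and
  replacement by a relation both preserve values in \<open>G\<close>, and the equivalence rules are
  immediate.\<close>

lemma (in group) pres_eq_imp_eval_word_eq:
  assumes "f \<in> X \<rightarrow> carrier G" "satisfies G f R" "pres_eq X R u v"
  shows "eval_word G f u = eval_word G f v"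
  using assms(3)
proof (induction rule: pres_eq.induct)
  case (cancel u v x b)
  have fx: "f x \<in> carrier G"
    using assms(1) cancel by auto
  have "eval_word G f ([(x, b), (x, \<not> b)] @ v) = eval_word G f v"
    using fx eval_word_closed[OF assms(1) \<open>v \<in> gwords X\<close>] by (simp add: m_assoc[symmetric])
  then show ?case
    using cancel eval_word_append[OF assms(1), of u "[(x, b), (x, \<not> b)] @ v"]
      eval_word_append[OF assms(1), of u v] by simp
next
  case (relation u v l r)
  then have "eval_word G f l = eval_word G f r"
    using assms(2) by (auto simp: satisfies_def)
  then show ?case
    using relation by (simp add: eval_word_append[OF assms(1)])
qed auto

section \<open>The tautological generators of a presented group\<close>

definition gen_class :: "'a set \<Rightarrow> ('a gword \<times> 'a gword) set \<Rightarrow> 'a \<Rightarrow> 'a gword set" where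
  "gen_class X R x = pres_class X R [(x, True)]"

lemma carrier_presented_group: "carrier (presented_group X R) = pres_class X R ` gwords X"
  by (simp add: presented_group_def)

lemma one_presented_group: "\<one>\<^bsub>presented_group X R\<^esub> = pres_class X R []"
  by (simp add: presented_group_def)

lemma gen_class_closed: "gen_class X R \<in> X \<rightarrow> carrier (presented_group X R)"
  by (auto simp: gen_class_def carrier_presented_group)

lemma inv_gen_class:
  assumes "x \<in> X"
  shows "inv\<^bsub>presented_group X R\<^esub> gen_class X R x = pres_class X R [(x, False)]"
proof -
  interpret P: group "presented_group X R" by (rule group_presented_group)
  have "pres_eq X R ([] @ [(x, False), (x, \<not> False)] @ []) ([] @ [])"
    by (rule pres_eq.cancel) (use assms in auto)
  then have "pres_class X R [(x, False)] \<otimes>\<^bsub>presented_group X R\<^esub> gen_class X R x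
      = \<one>\<^bsub>presented_group X R\<^esub>"
    using assms
    by (simp add: gen_class_def presented_group_mult one_presented_group pres_class_eq_iff)
  then show ?thesis
    by (intro P.inv_equality) (use assms in \<open>auto simp: gen_class_def carrier_presented_group\<close>)
qed

text \<open>Identifies the identity map of a presented group with evaluation at its own generators,
  so that composites of homomorphisms can be compared through assignments of letters.\<close>

lemma eval_word_gen_class:
  "w \<in> gwords X \<Longrightarrow> eval_word (presented_group X R) (gen_class X R) w = pres_class X R w"
proof (induction w)
  case Nil
  then show ?case by (simp add: one_presented_group)
next
  case (Cons a w)
  obtain x b where a: "a = (x, b)" by (cases a)
  then have x: "x \<in> X" and w: "w \<in> gwords X"
    using Cons.prems by auto
  have "(if b then gen_class X R x else inv\<^bsub>presented_group X R\<^esub> gen_class X R x)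
      = pres_class X R [(x, b)]"
    using inv_gen_class[OF x] by (simp add: gen_class_def)
  then show ?case
    using Cons.IH[OF w] x w by (simp add: a presented_group_mult)
qed

text \<open>The inclusion matters: \<open>pres_eq\<close> applies a pair only if both sides are
  words over \<open>X\<close>, so a stray pair would impose nothing.\<close>

lemma satisfies_gen_class:
  assumes "R \<subseteq> gwords X \<times> gwords X"
  shows "satisfies (presented_group X R) (gen_class X R) R"
  unfolding satisfies_def
proof clarify
  fix l r assume lr: "(l, r) \<in> R"
  then have w: "l \<in> gwords X" "r \<in> gwords X"
    using assms by auto
  have "pres_eq X R ([] @ l @ []) ([] @ r @ [])"
    by (rule pres_eq.relation) (use lr w in auto)
  then show "eval_word (presented_group X R) (gen_class X R) l
      = eval_word (presented_group X R) (gen_class X R) r"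
    using w by (simp add: eval_word_gen_class pres_class_eq_iff)
qed

text \<open>The universal property of a presentation: a map of generators that respects the
  relations extends to a homomorphism.\<close>

lemma (in group) presented_group_hom:
  assumes "f \<in> X \<rightarrow> carrier G" "satisfies G f R"
  obtains h where "h \<in> hom (presented_group X R) G"
    "\<And>w. w \<in> gwords X \<Longrightarrow> h (pres_class X R w) = eval_word G f w"
proof -
  \<comment> \<open>An arbitrary representative is evaluated; congruent words have equal values, so
    the choice is harmless.\<close>
  define h where "h A = eval_word G f (SOME w. w \<in> A)" for A
  have h: "h (pres_class X R w) = eval_word G f w" if "w \<in> gwords X" for w
  proof -
    have "w \<in> pres_class X R w"
      using that by (simp add: pres_class_def pres_eq.refl)
    then have "(SOME v. v \<in> pres_class X R w) \<in> pres_class X R w"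
      by (rule someI)
    then have "pres_eq X R w (SOME v. v \<in> pres_class X R w)"
      by (simp add: pres_class_def)
    then show ?thesis
      unfolding h_def using pres_eq_imp_eval_word_eq[OF assms] by metis
  qed
  have "h \<in> hom (presented_group X R) G"
    by (rule homI)
      (auto simp: carrier_presented_group presented_group_mult h eval_word_append[OF assms(1)]
        eval_word_closed[OF assms(1)])
  then show ?thesis
    using h that by blast
qed

section \<open>Comparison of two presentations\<close>

lemma hom_eval_word:
  assumes "group G" "group H" "h \<in> hom G H" "f \<in> X \<rightarrow> carrier G" "w \<in> gwords X"
  shows "h (eval_word G f w) = eval_word H (h \<circ> f) w"
proof -
  interpret G: group G by fact
  interpret group_hom G H h
    using assms by (simp add: group_hom_def group_hom_axioms_def)
  show ?thesis
    using assms(5)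
  proof (induction w)
    case (Cons a w)
    obtain x b where a: "a = (x, b)" by (cases a)
    have "f x \<in> carrier G" "eval_word G f w \<in> carrier G"
      using Cons.prems assms(4) G.eval_word_closed[OF assms(4), of w] by (auto simp: a)
    then show ?case
      using Cons by (simp add: a)
  qed simp
qed

lemma eval_word_cong:
  "w \<in> gwords X \<Longrightarrow> (\<And>x. x \<in> X \<Longrightarrow> f x = g x) \<Longrightarrow> eval_word G f w = eval_word G g w"
  by (induction w) auto

text \<open>A general Tietze transformation: \<open>f\<close> says how the generators in \<open>Y\<close> are expressed by
  those in \<open>X\<close>.\<close>

lemma presented_group_iso_extend:
  fixes X Y :: "'a set" and R Q :: "('a gword \<times> 'a gword) set"
  defines "P \<equiv> presented_group X R" and "P' \<equiv> presented_group Y Q"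
  assumes "X \<subseteq> Y"
    and f: "f \<in> Y \<rightarrow> carrier P" "satisfies P f Q" "\<And>x. x \<in> X \<Longrightarrow> f x = gen_class X R x"
    and R: "satisfies P' (gen_class Y Q) R"
    and inverse: "\<And>h y. h \<in> hom P P' \<Longrightarrow> (\<And>x. x \<in> X \<Longrightarrow> h (gen_class X R x) = gen_class Y Q x) \<Longrightarrow>
      y \<in> Y \<Longrightarrow> h (f y) = gen_class Y Q y"
  shows "P \<cong> P'"
proof -
  have P: "group P" and P': "group P'"
    by (simp_all add: P_def P'_def group_presented_group)
  have gX: "gen_class X R \<in> X \<rightarrow> carrier P" and gY: "gen_class Y Q \<in> Y \<rightarrow> carrier P'"
    by (simp_all add: P_def P'_def gen_class_closed)
  have gXY: "gen_class Y Q \<in> X \<rightarrow> carrier P'"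
    using gY \<open>X \<subseteq> Y\<close> by auto
  \<comment> \<open>The maps \<open>h\<close> and \<open>k\<close> come from the universal property
    and are shown to be mutually inverse. Since \<open>h\<close> only arises here,
    \<open>inverse\<close> speaks of every homomorphism with the prescribed values on
    \<open>X\<close>.\<close>
  obtain h where h: "h \<in> hom P P'"
    "\<And>w. w \<in> gwords X \<Longrightarrow> h (pres_class X R w) = eval_word P' (gen_class Y Q) w"
    using group.presented_group_hom[OF P' gXY R] P_def by blast
  obtain k where k: "k \<in> hom P' P"
    "\<And>w. w \<in> gwords Y \<Longrightarrow> k (pres_class Y Q w) = eval_word P f w"
    using group.presented_group_hom[OF P f(1,2)] P'_def by blast
  have h_gen: "h (gen_class X R x) = gen_class Y Q x" if "x \<in> X" for x
    using that gXY group.is_monoid[OF P']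
    by (simp add: gen_class_def[of X] h(2) Pi_iff monoid.r_one)
  \<comment> \<open>This composite evaluates words over \<open>X\<close> with \<open>f\<close>,
    which agrees there with the tautological assignment.\<close>
  have "k (h A) = A" if A: "A \<in> carrier P" for A
  proof -
    obtain w where w: "w \<in> gwords X" "A = pres_class X R w"
      using A by (auto simp: P_def carrier_presented_group)
    then have "w \<in> gwords Y"
      using \<open>X \<subseteq> Y\<close> by (auto simp: gwords_def)
    then have "k (h A) = eval_word P f w"
      using w h(2) k(2) by (simp add: P'_def eval_word_gen_class)
    also have "\<dots> = eval_word P (gen_class X R) w"
      by (rule eval_word_cong[OF w(1)]) (rule f(3))
    also have "\<dots> = A"
      using w by (simp add: P_def eval_word_gen_class)
    finally show ?thesis .
  qed
  moreover have "h (k B) = B" if B: "B \<in> carrier P'" for B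
  proof -
    obtain w where w: "w \<in> gwords Y" "B = pres_class Y Q w"
      using B by (auto simp: P'_def carrier_presented_group)
    then have "h (k B) = eval_word P' (h \<circ> f) w"
      using k(2) hom_eval_word[OF P P' h(1) f(1)] by simp
    also have "\<dots> = eval_word P' (gen_class Y Q) w"
      by (rule eval_word_cong[OF w(1)]) (use inverse[OF h(1) h_gen] in simp)
    also have "\<dots> = B"
      using w by (simp add: P'_def eval_word_gen_class)
    finally show ?thesis .
  qed
  moreover have "h \<in> carrier P \<rightarrow> carrier P'" "k \<in> carrier P' \<rightarrow> carrier P"
    using h(1) k(1) by (auto simp: hom_def)
  ultimately have "bij_betw h (carrier P) (carrier P')"
    by (intro bij_betw_byWitness[where f' = k]) auto
  then show ?thesis
    using h(1) by (auto simp: is_iso_def iso_def)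
qed

section \<open>Sequences with constant product of consecutive terms\<close>

text \<open>Suited to two-term recursions: the induction carries the pair \<open>P i\<close>,
  \<open>P (i + 1)\<close> in both directions from 0.\<close>

lemma int_induct_two_sided [case_names zero one up down]:
  fixes P :: "int \<Rightarrow> bool"
  assumes "P 0" "P 1"
    and up: "\<And>i. P (i - 1) \<Longrightarrow> P i \<Longrightarrow> P (i + 1)"
    and down: "\<And>i. P (i + 1) \<Longrightarrow> P i \<Longrightarrow> P (i - 1)"
  shows "P i"
proof -
  have "P i \<and> P (i + 1)"
  proof (induction i rule: int_induct[where k = 0])
    case base
    then show ?case using assms by simp
  next
    case (step1 i)
    then show ?case using up[of "i + 1"] by simp
  next
    case (step2 i)
    then show ?case using down[of i] by simp
  qed
  then show ?thesis ..
qed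

context group
begin

text \<open>Relation (3) in an arbitrary group, with the constant product normalised to its value at
  index 1.\<close>

definition chain :: "(int \<Rightarrow> 'a) \<Rightarrow> bool" where
  "chain t \<longleftrightarrow> range t \<subseteq> carrier G \<and> (\<forall>i. t i \<otimes> t (i - 1) = t 1 \<otimes> t 0)"

lemma chain_closed: "chain t \<Longrightarrow> t i \<in> carrier G"
  by (auto simp: chain_def)

lemma chain_mult: "chain t \<Longrightarrow> t i \<otimes> t (i - 1) = t 1 \<otimes> t 0"
  by (auto simp: chain_def)

lemma chain_mult': "chain t \<Longrightarrow> t (i + 1) \<otimes> t i = t 1 \<otimes> t 0"
  using chain_mult[of t "i + 1"] by simp

text \<open>The shape \<open>x y = y z\<close> with \<open>y = t i\<close> in the middle, as the
  propagation lemmas below expect it.\<close>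

lemma chain_step: "chain t \<Longrightarrow> t (i + 1) \<otimes> t i = t i \<otimes> t (i - 1)"
  using chain_mult chain_mult' by metis

text \<open>Right cancellation determines the next term and left cancellation the previous
  one.\<close>

lemma chain_unique:
  assumes "chain t" "chain u" "t 0 = u 0" "t 1 = u 1"
  shows "t i = u i"
proof (induction i rule: int_induct_two_sided)
  case (up i)
  have "t (i + 1) \<otimes> t i = u (i + 1) \<otimes> t i"
    using assms up chain_mult' by metis
  then show ?case
    using assms chain_closed by (metis right_cancel)
next
  case (down i)
  have "t i \<otimes> t (i - 1) = t i \<otimes> u (i - 1)"
    using assms down chain_mult by metis
  then show ?case
    using assms chain_closed by (metis Units_l_cancel Units_eq)
qed (use assms in simp_all)

text \<open>Conjugates of \<open>a\<close> and \<open>b\<close> by powers of \<open>c = b a\<close>.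
  As \<open>div\<close> rounds down, \<open>i\<close> is \<open>2k\<close> or \<open>2k + 1\<close>
  with \<open>k = i div 2\<close> for negative \<open>i\<close> too.\<close>

definition chain_of :: "'a \<Rightarrow> 'a \<Rightarrow> int \<Rightarrow> 'a" where
  "chain_of a b i =
    (b \<otimes> a) [^] (i div 2) \<otimes> (if even i then a else b) \<otimes> inv ((b \<otimes> a) [^] (i div 2))"

lemma chain_chain_of:
  assumes a: "a \<in> carrier G" and b: "b \<in> carrier G"
  shows "chain (chain_of a b)"
    and "chain_of a b 0 = a" "chain_of a b 1 = b"
proof -
  show 01: "chain_of a b 0 = a" "chain_of a b 1 = b"
    using assms by (simp_all add: chain_of_def)
  define c where "c = b \<otimes> a"
  have c: "c \<in> carrier G"
    using assms by (simp add: c_def)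
  have inv_cancel: "inv x \<otimes> (x \<otimes> y) = y" if "x \<in> carrier G" "y \<in> carrier G" for x y
    using that by (simp add: m_assoc[symmetric])
  have conj: "c [^] k \<otimes> c \<otimes> inv (c [^] k) = c" for k :: int
  proof -
    have "c [^] k \<otimes> c = c \<otimes> c [^] k"
      using c int_pow_mult[of c k 1] int_pow_mult[of c 1 k] by (simp add: add.commute)
    then show ?thesis
      using c by (simp add: m_assoc)
  qed
  have "chain_of a b i \<otimes> chain_of a b (i - 1) = c" for i
  proof (cases "even i")
    case True
    then obtain k where k: "i = 2 * k" by blast
    then have i: "i div 2 = k" "(i - 1) div 2 = k - 1" "odd (i - 1)"
      by auto
    \<comment> \<open>For even \<open>i\<close> the previous term is conjugated by the lower power;
      writing \<open>c [^] k\<close> as \<open>d c\<close> gives both factors the same outer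
      \<open>d\<close>.\<close>
    define d where "d = c [^] (k - 1)"
    have d: "d \<in> carrier G"
      using c by (simp add: d_def)
    have ck: "c [^] k = d \<otimes> c"
      using c int_pow_mult[of c "k - 1" 1] by (simp add: d_def)
    have "chain_of a b i \<otimes> chain_of a b (i - 1)
        = (d \<otimes> c \<otimes> a \<otimes> inv (d \<otimes> c)) \<otimes> (d \<otimes> b \<otimes> inv d)"
      using True i by (simp add: chain_of_def c_def[symmetric] ck d_def)
    also have "\<dots> = d \<otimes> c \<otimes> (a \<otimes> inv c \<otimes> b) \<otimes> inv d"
      using a b c d by (simp add: inv_mult_group m_assoc inv_cancel)
    also have "a \<otimes> inv c \<otimes> b = \<one>"
      using a b by (simp add: c_def inv_mult_group m_assoc inv_cancel)
    also have "d \<otimes> c \<otimes> \<one> \<otimes> inv d = c"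
      using c d conj[of "k - 1"] by (simp add: d_def)
    finally show ?thesis .
  next
    case False
    then obtain k where k: "i = 2 * k + 1" by (elim oddE)
    then have i: "i div 2 = k" "(i - 1) div 2 = k" "even (i - 1)"
      by auto
    define d where "d = c [^] k"
    have d: "d \<in> carrier G"
      using c by (simp add: d_def)
    \<comment> \<open>For odd \<open>i\<close> both factors are conjugated by the same power, so
      their product is a conjugate of \<open>b a = c\<close> by a power of \<open>c\<close>.\<close>
    have "chain_of a b i \<otimes> chain_of a b (i - 1) = (d \<otimes> b \<otimes> inv d) \<otimes> (d \<otimes> a \<otimes> inv d)"
      using False i by (simp add: chain_of_def c_def[symmetric] d_def)
    also have "\<dots> = d \<otimes> c \<otimes> inv d"
      using a b d by (simp add: c_def m_assoc inv_cancel)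
    also have "\<dots> = c"
      using conj by (simp add: d_def)
    finally show ?thesis .
  qed
  moreover have "chain_of a b i \<in> carrier G" for i
    using assms by (simp add: chain_of_def)
  ultimately show "chain (chain_of a b)"
    using 01 by (auto simp: chain_def c_def)
qed

section \<open>Propagation of relations along a chain\<close>

definition braided :: "'a \<Rightarrow> 'a \<Rightarrow> bool" where
  "braided x s \<longleftrightarrow> x \<otimes> (s \<otimes> x) = s \<otimes> (x \<otimes> s)"

text \<open>Put \<open>c = x y = y z\<close>. Using \<open>y s y = s y s\<close>, the word
  \<open>s c s c\<close> becomes \<open>(s x s)(y s z)\<close> and \<open>c s c s\<close> becomes
  \<open>(x s y)(s z s)\<close>, while \<open>(x s x)(y s z) = (x s y)(z s z)\<close>. These
  factorisations make the two-out-of-three argument a matter of cancellation.\<close>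

lemma braided_triple:
  assumes carr: "x \<in> carrier G" "y \<in> carrier G" "z \<in> carrier G" "s \<in> carrier G"
    and xy: "x \<otimes> y = y \<otimes> z" and y: "braided y s"
  shows "s \<otimes> (y \<otimes> z) \<otimes> (s \<otimes> (y \<otimes> z)) = s \<otimes> (x \<otimes> s) \<otimes> (y \<otimes> (s \<otimes> z))"
      (is ?A)
    and "y \<otimes> z \<otimes> s \<otimes> (y \<otimes> z \<otimes> s) = x \<otimes> (s \<otimes> y) \<otimes> (s \<otimes> (z \<otimes> s))" (is ?B)
    and "x \<otimes> (s \<otimes> x) \<otimes> (y \<otimes> (s \<otimes> z)) = x \<otimes> (s \<otimes> y) \<otimes> (z \<otimes> (s \<otimes> z))" (is ?C)
proof -
  \<comment> \<open>The relations are restated with a tail \<open>w\<close> so that they rewrite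
    inside right-nested products.\<close>
  have xy': "x \<otimes> (y \<otimes> w) = y \<otimes> (z \<otimes> w)" if "w \<in> carrier G" for w
    using xy carr that by (metis m_assoc)
  have y': "y \<otimes> (s \<otimes> (y \<otimes> w)) = s \<otimes> (y \<otimes> (s \<otimes> w))" if "w \<in> carrier G" for w
  proof -
    have "y \<otimes> (s \<otimes> y) \<otimes> w = s \<otimes> (y \<otimes> s) \<otimes> w"
      using y by (simp add: braided_def)
    then show ?thesis
      using carr that by (simp add: m_assoc)
  qed
  show ?A
    using carr by (simp add: m_assoc xy'[symmetric] y'[symmetric])
  have "x \<otimes> (s \<otimes> y) \<otimes> (s \<otimes> (z \<otimes> s)) = x \<otimes> (y \<otimes> (s \<otimes> (y \<otimes> (z \<otimes> s))))"
    using carr by (simp add: m_assoc y')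
  also have "\<dots> = y \<otimes> z \<otimes> s \<otimes> (y \<otimes> z \<otimes> s)"
    using carr by (simp add: m_assoc xy')
  finally show ?B ..
  show ?C
    using carr by (simp add: m_assoc xy')
qed

text \<open>Multiply the braid relation for \<open>x\<close> on the right by \<open>y s z\<close>,
  pass to the other factorisation by \<open>braided_triple\<close>, and cancel \<open>x s y\<close>
  on the left.\<close>

lemma braided_propagate:
  assumes carr: "x \<in> carrier G" "y \<in> carrier G" "z \<in> carrier G" "s \<in> carrier G"
    and xy: "x \<otimes> y = y \<otimes> z" and y: "braided y s"
    and c: "s \<otimes> (y \<otimes> z) \<otimes> (s \<otimes> (y \<otimes> z)) = y \<otimes> z \<otimes> s \<otimes> (y \<otimes> z \<otimes> s)"
  shows "braided x s \<longleftrightarrow> braided z s"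
proof -
  note triple = braided_triple[OF carr xy y]
  have "braided x s \<longleftrightarrow> x \<otimes> (s \<otimes> x) \<otimes> (y \<otimes> (s \<otimes> z)) = s \<otimes> (x \<otimes> s) \<otimes> (y \<otimes> (s \<otimes> z))"
    using carr by (simp add: braided_def)
  also have "\<dots> \<longleftrightarrow> x \<otimes> (s \<otimes> y) \<otimes> (z \<otimes> (s \<otimes> z)) = x \<otimes> (s \<otimes> y) \<otimes> (s \<otimes> (z \<otimes> s))"
    using triple c by simp
  also have "\<dots> \<longleftrightarrow> braided z s"
    using carr by (simp add: braided_def)
  finally show ?thesis .
qed

lemma chain_braided_iff:
  assumes t: "chain t" and s: "s \<in> carrier G"
  defines "c \<equiv> t 1 \<otimes> t 0"
  shows "(\<forall>i. braided (t i) s) \<longleftrightarrow>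
    braided (t 0) s \<and> braided (t 1) s \<and> s \<otimes> c \<otimes> (s \<otimes> c) = c \<otimes> s \<otimes> (c \<otimes> s)"
proof (intro iffI conjI allI)
  assume br: "\<forall>i. braided (t i) s"
  \<comment> \<open>The triple is \<open>t 2\<close>, \<open>t 1\<close>, \<open>t 0\<close>, for
    which \<open>y z\<close> is exactly \<open>c\<close>.\<close>
  have step: "t 2 \<otimes> t 1 = t 1 \<otimes> t 0"
    using chain_step[OF t, of 1] by simp
  note triple = braided_triple[OF chain_closed[OF t] chain_closed[OF t] chain_closed[OF t] s
    step br[rule_format]]
  show "s \<otimes> c \<otimes> (s \<otimes> c) = c \<otimes> s \<otimes> (c \<otimes> s)"
    unfolding c_def triple(1,2)
    using triple(3) br by (simp add: braided_def)
next
  fix i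
  assume *: "braided (t 0) s \<and> braided (t 1) s \<and> s \<otimes> c \<otimes> (s \<otimes> c) = c \<otimes> s \<otimes> (c \<otimes> s)"
  \<comment> \<open>The condition on \<open>c\<close> serves every index, because
    \<open>t i \<otimes> t (i - 1)\<close> does not depend on \<open>i\<close>.\<close>
  have step: "braided (t (i + 1)) s \<longleftrightarrow> braided (t (i - 1)) s" if "braided (t i) s" for i
    by (rule braided_propagate[of _ "t i"])
      (use * that t s in \<open>simp_all add: chain_closed chain_step chain_mult c_def\<close>)
  show "braided (t i) s"
    by (induction i rule: int_induct_two_sided) (use * step in auto)
qed auto

text \<open>After right multiplication by \<open>y\<close>, the sides become
  \<open>x s y = x y s = y z s\<close> and \<open>s x y = s y z = y s z\<close>.\<close>

lemma commute_propagate: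
  assumes carr: "x \<in> carrier G" "y \<in> carrier G" "z \<in> carrier G" "s \<in> carrier G"
    and xy: "x \<otimes> y = y \<otimes> z" and y: "y \<otimes> s = s \<otimes> y"
  shows "x \<otimes> s = s \<otimes> x \<longleftrightarrow> z \<otimes> s = s \<otimes> z"
proof -
  have "x \<otimes> s = s \<otimes> x \<longleftrightarrow> x \<otimes> s \<otimes> y = s \<otimes> x \<otimes> y"
    using carr by simp
  also have "x \<otimes> s \<otimes> y = y \<otimes> (z \<otimes> s)"
    using carr xy y by (metis m_assoc)
  also have "s \<otimes> x \<otimes> y = y \<otimes> (s \<otimes> z)"
    using carr xy y by (metis m_assoc)
  also have "y \<otimes> (z \<otimes> s) = y \<otimes> (s \<otimes> z) \<longleftrightarrow> z \<otimes> s = s \<otimes> z"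
    using carr by simp
  finally show ?thesis .
qed

lemma chain_commute:
  assumes t: "chain t" and s: "s \<in> carrier G" and "t 0 \<otimes> s = s \<otimes> t 0" "t 1 \<otimes> s = s \<otimes> t 1"
  shows "t i \<otimes> s = s \<otimes> t i"
proof (induction i rule: int_induct_two_sided)
  case (up i)
  then show ?case
    using commute_propagate[OF _ _ _ s chain_step[OF t, of i]] t by (simp add: chain_closed)
next
  case (down i)
  then show ?case
    using commute_propagate[OF _ _ _ s chain_step[OF t, of i]] t by (simp add: chain_closed)
qed (use assms in auto)

text \<open>The hypothesis makes \<open>x\<close> a conjugate of \<open>z\<close>; concretely
  \<open>x x y = x y z = y z z\<close>.\<close>

lemma involution_propagate:
  assumes carr: "x \<in> carrier G" "y \<in> carrier G" "z \<in> carrier G"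
    and xy: "x \<otimes> y = y \<otimes> z"
  shows "x \<otimes> x = \<one> \<longleftrightarrow> z \<otimes> z = \<one>"
proof -
  have "x \<otimes> x = \<one> \<longleftrightarrow> x \<otimes> x \<otimes> y = \<one> \<otimes> y"
    using carr by (metis right_cancel m_closed one_closed)
  also have "x \<otimes> x \<otimes> y = y \<otimes> (z \<otimes> z)"
    using carr xy by (metis m_assoc)
  also have "y \<otimes> (z \<otimes> z) = \<one> \<otimes> y \<longleftrightarrow> z \<otimes> z = \<one>"
    using carr by (metis Units_l_cancel Units_eq l_one r_one m_closed one_closed)
  finally show ?thesis .
qed

lemma chain_involution:
  assumes t: "chain t" and "t 0 \<otimes> t 0 = \<one>" "t 1 \<otimes> t 1 = \<one>"
  shows "t i \<otimes> t i = \<one>"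
proof (induction i rule: int_induct_two_sided)
  case (up i)
  then show ?case
    using involution_propagate[OF _ _ _ chain_step[OF t, of i]] t by (simp add: chain_closed)
next
  case (down i)
  then show ?case
    using involution_propagate[OF _ _ _ chain_step[OF t, of i]] t by (simp add: chain_closed)
qed (use assms in auto)

end

text \<open>Lets \<open>chain_unique\<close> identify the image of a chain from its terms at 0 and 1
  alone.\<close>

lemma hom_chain:
  assumes "group G" "group H" "h \<in> hom G H" "group.chain G t"
  shows "group.chain H (h \<circ> t)"
proof -
  interpret G: group G by fact
  interpret H: group H by fact
  interpret group_hom G H h
    using assms by (simp add: group_hom_def group_hom_axioms_def)
  have "h (t i) \<otimes>\<^bsub>H\<^esub> h (t (i - 1)) = h (t 1) \<otimes>\<^bsub>H\<^esub> h (t 0)" for i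
    using G.chain_mult[OF assms(4), of i] G.chain_closed[OF assms(4)] by (metis hom_mult)
  then show ?thesis
    using G.chain_closed[OF assms(4)] by (auto simp: H.chain_def)
qed

section \<open>The two presentations\<close>

text \<open>The bound on \<open>n\<close> makes \<open>S 1\<close>, \<open>S 2\<close>,
  \<open>S 3\<close> generators, so that their values lie in the carrier.\<close>

lemma (in group) satisfies_TS_iff:
  assumes "3 \<le> n" "f \<in> generators n I \<rightarrow> carrier G"
  shows "satisfies G f (TS_relations n I) \<longleftrightarrow>
    (\<forall>i\<in>I. \<forall>j\<in>{1, 2, 3}. braided (f (T i)) (f (S j))) \<and>
    (\<forall>i\<in>I. \<forall>j. 4 \<le> j \<and> j \<le> n \<longrightarrow> f (T i) \<otimes> f (S j) = f (S j) \<otimes> f (T i))"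
proof -
  have T: "f (T i) \<in> carrier G" if "i \<in> I" for i
    using assms that by (auto simp: generators_def)
  have S: "f (S j) \<in> carrier G" if "1 \<le> j" "j \<le> n" for j
    using assms that by (auto simp: generators_def)
  have br: "eval_word G f (fst (braid (T i) (S j))) = eval_word G f (snd (braid (T i) (S j)))
      \<longleftrightarrow> braided (f (T i)) (f (S j))" if "i \<in> I" "j \<in> {1, 2, 3}" for i j
    using T S that assms(1) by (auto simp: braid_def pos_word_def braided_def)
  have co: "eval_word G f (fst (commute (T i) (S j))) = eval_word G f (snd (commute (T i) (S j)))
      \<longleftrightarrow> f (T i) \<otimes> f (S j) = f (S j) \<otimes> f (T i)" if "i \<in> I" "4 \<le> j" "j \<le> n" for i j
    using T S that by (auto simp: commute_def pos_word_def)
  have "satisfies G f (TS_relations n I) \<longleftrightarrow>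
      (\<forall>i\<in>I. \<forall>j\<in>{1, 2, 3}.
        eval_word G f (fst (braid (T i) (S j))) = eval_word G f (snd (braid (T i) (S j)))) \<and>
      (\<forall>i\<in>I. \<forall>j. 4 \<le> j \<and> j \<le> n \<longrightarrow>
        eval_word G f (fst (commute (T i) (S j))) = eval_word G f (snd (commute (T i) (S j))))"
    unfolding satisfies_def TS_relations_def case_prod_unfold ball_Un by blast
  then show ?thesis
    using br co by auto
qed

lemma (in group) satisfies_elliptic_iff:
  assumes "3 \<le> n" "f \<in> generators n {0, 1} \<rightarrow> carrier G"
  defines "c \<equiv> f (T 1) \<otimes> f (T 0)"
  shows "satisfies G f (elliptic_relations n) \<longleftrightarrow>
    satisfies G f (TS_relations n {0, 1}) \<and>
    (\<forall>j\<in>{1, 2, 3}. f (S j) \<otimes> c \<otimes> (f (S j) \<otimes> c) = c \<otimes> f (S j) \<otimes> (c \<otimes> f (S j))) \<and>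
    satisfies G f (S_relations n)"
proof -
  have T: "f (T 0) \<in> carrier G" "f (T 1) \<in> carrier G"
    using assms by (auto simp: generators_def)
  have S: "f (S j) \<in> carrier G" if "j \<in> {1, 2, 3}" for j
  proof -
    have "S j \<in> generators n {0, 1}"
      using assms(1) that by (auto simp: generators_def)
    then show ?thesis using assms(2) by auto
  qed
  have "satisfies G f {(pos_word [S j, T 1, T 0, S j, T 1, T 0],
        pos_word [T 1, T 0, S j, T 1, T 0, S j]) | j. j \<in> {1, 2, 3}} \<longleftrightarrow>
      (\<forall>j\<in>{1, 2, 3}. eval_word G f (pos_word [S j, T 1, T 0, S j, T 1, T 0])
        = eval_word G f (pos_word [T 1, T 0, S j, T 1, T 0, S j]))"
    unfolding satisfies_def by blast
  also have "\<dots> \<longleftrightarrow>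
      (\<forall>j\<in>{1, 2, 3}. f (S j) \<otimes> c \<otimes> (f (S j) \<otimes> c) = c \<otimes> f (S j) \<otimes> (c \<otimes> f (S j)))"
    by (rule ball_cong) (use T S in \<open>simp_all add: c_def pos_word_def m_assoc\<close>)
  finally show ?thesis
    by (simp add: elliptic_relations_def conj_assoc)
qed

lemma (in group) satisfies_elliptic'_iff:
  assumes "f \<in> generators n UNIV \<rightarrow> carrier G"
  shows "satisfies G f (elliptic_relations' n) \<longleftrightarrow>
    satisfies G f (TS_relations n UNIV) \<and> chain (\<lambda>i. f (T i)) \<and> satisfies G f (S_relations n)"
proof -
  have T: "f (T i) \<in> carrier G" for i
    using assms by (auto simp: generators_def)
  have "satisfies G f {(pos_word [T i, T (i - 1)], pos_word [T j, T (j - 1)]) | i j. True} \<longleftrightarrow>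
      (\<forall>i j. eval_word G f (pos_word [T i, T (i - 1)]) = eval_word G f (pos_word [T j, T (j - 1)]))"
    unfolding satisfies_def by blast
  also have "\<dots> \<longleftrightarrow> (\<forall>i j. f (T i) \<otimes> f (T (i - 1)) = f (T j) \<otimes> f (T (j - 1)))"
    using T by (simp add: pos_word_def)
  \<comment> \<open>Comparing all pairs of indices amounts to comparing each with
    \<open>j = 1\<close>, where \<open>j - 1 = 0\<close>.\<close>
  also have "\<dots> \<longleftrightarrow> chain (\<lambda>i. f (T i))"
    unfolding chain_def using T by (auto, metis diff_self)
  finally show ?thesis
    by (simp add: elliptic_relations'_def conj_assoc)
qed

lemma (in group) satisfies_quadratic_iff:
  assumes "f \<in> generators n I \<rightarrow> carrier G"
  shows "satisfies G f (quadratic_relations n I) \<longleftrightarrow>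
    (\<forall>i\<in>I. f (T i) \<otimes> f (T i) = \<one>) \<and> (\<forall>j\<in>{1..n}. f (S j) \<otimes> f (S j) = \<one>)"
proof -
  have "f x \<in> carrier G" if "x \<in> generators n I" for x
    using assms that by auto
  then show ?thesis
    by (auto simp: satisfies_def quadratic_relations_def quadratic_def pos_word_def generators_def)
qed

text \<open>These relations involve only letters \<open>S j\<close>, so changing the values of the
  \<open>T i\<close> has no effect.\<close>

lemma satisfies_S_relations_cong:
  "(\<And>j. f (S j) = g (S j)) \<Longrightarrow>
    satisfies G f (S_relations n) \<longleftrightarrow> satisfies G g (S_relations n)"
  unfolding satisfies_def S_relations_def braid_def commute_def pos_word_def
  by (intro ball_cong) auto

lemma elliptic_relations_subset:
  assumes "3 \<le> n"
  shows "elliptic_relations n \<subseteq> gwords (generators n {0, 1}) \<times> gwords (generators n {0, 1})"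
  using assms
  by (auto simp: elliptic_relations_def TS_relations_def S_relations_def braid_def commute_def
      pos_word_def generators_def)

lemma elliptic_relations'_subset:
  assumes "3 \<le> n"
  shows "elliptic_relations' n \<subseteq> gwords (generators n UNIV) \<times> gwords (generators n UNIV)"
  using assms
  by (auto simp: elliptic_relations'_def TS_relations_def S_relations_def braid_def commute_def
      pos_word_def generators_def)

lemma quadratic_relations_subset:
  "quadratic_relations n I \<subseteq> gwords (generators n I) \<times> gwords (generators n I)"
  by (auto simp: quadratic_relations_def quadratic_def pos_word_def)

text \<open>The set \<open>K\<close> switches the quadratic relations on (\<open>K = UNIV\<close>) or off (\<open>K = {}\<close>).\<close>

lemma elliptic_presentations_iso:
  fixes K :: "(gen gword \<times> gen gword) set"
  assumes n: "3 \<le> n" and K: "K = {} \<or> K = UNIV"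
  shows "presented_group (generators n {0, 1})
      (elliptic_relations n \<union> quadratic_relations n {0, 1} \<inter> K)
    \<cong> presented_group (generators n UNIV)
      (elliptic_relations' n \<union> quadratic_relations n UNIV \<inter> K)"
proof -
  define X where "X = generators n {0, 1}"
  define Y where "Y = generators n UNIV"
  define R where "R = elliptic_relations n \<union> quadratic_relations n {0, 1} \<inter> K"
  define Q where "Q = elliptic_relations' n \<union> quadratic_relations n UNIV \<inter> K"
  define P where "P = presented_group X R"
  define P' where "P' = presented_group Y Q"
  interpret P: group P unfolding P_def by (rule group_presented_group)
  interpret P': group P' unfolding P'_def by (rule group_presented_group)
  let ?g = "gen_class X R" and ?g' = "gen_class Y Q"
  have g: "?g \<in> generators n {0, 1} \<rightarrow> carrier P" and g': "?g' \<in> generators n UNIV \<rightarrow> carrier P'"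
    using gen_class_closed[of X R] gen_class_closed[of Y Q]
    by (simp_all add: P_def P'_def X_def Y_def)
  have XY: "X \<subseteq> Y"
    by (auto simp: X_def Y_def generators_def)
  have g'X: "?g' \<in> generators n {0, 1} \<rightarrow> carrier P'"
    using g' XY by (auto simp: X_def Y_def)
  have R: "satisfies P ?g R"
    unfolding P_def using elliptic_relations_subset[OF n] quadratic_relations_subset[of n "{0, 1}"]
    by (intro satisfies_gen_class) (auto simp: X_def R_def)
  have Q: "satisfies P' ?g' Q"
    unfolding P'_def using elliptic_relations'_subset[OF n] quadratic_relations_subset[of n UNIV]
    by (intro satisfies_gen_class) (auto simp: Y_def Q_def)
  have gS: "?g (S j) \<in> carrier P" if "j \<in> {1..n}" for j
    using g that by (auto simp: generators_def)
  have gT: "?g (T 0) \<in> carrier P" "?g (T 1) \<in> carrier P"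
    using g by (auto simp: generators_def)

  \<comment> \<open>The missing generators are expressed in \<open>P\<close> by the explicit chain
    through the classes of \<open>T 0\<close> and \<open>T 1\<close>; \<open>f\<close> is the
    resulting assignment.\<close>
  define t where "t = P.chain_of (?g (T 0)) (?g (T 1))"
  note chain_t = P.chain_chain_of[OF gT, folded t_def]
  define f where "f = (\<lambda>x. case x of T i \<Rightarrow> t i | S j \<Rightarrow> ?g (S j))"
  have f_simps [simp]: "f (T i) = t i" "f (S j) = ?g (S j)" for i j
    by (simp_all add: f_def)
  have f: "f \<in> generators n UNIV \<rightarrow> carrier P"
    using gS P.chain_closed[OF chain_t(1)] by (auto simp: generators_def)
  have R_iff: "satisfies P ?g (TS_relations n {0, 1})"
    "\<forall>j\<in>{1, 2, 3}. ?g (S j) \<otimes>\<^bsub>P\<^esub> (t 1 \<otimes>\<^bsub>P\<^esub> t 0) \<otimes>\<^bsub>P\<^esub> (?g (S j) \<otimes>\<^bsub>P\<^esub> (t 1 \<otimes>\<^bsub>P\<^esub> t 0))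
      = t 1 \<otimes>\<^bsub>P\<^esub> t 0 \<otimes>\<^bsub>P\<^esub> ?g (S j) \<otimes>\<^bsub>P\<^esub> (t 1 \<otimes>\<^bsub>P\<^esub> t 0 \<otimes>\<^bsub>P\<^esub> ?g (S j))"
    "satisfies P ?g (S_relations n)"
    using R P.satisfies_elliptic_iff[OF n g] by (simp_all add: R_def chain_t)
  \<comment> \<open>Here (P3) is used to spread the braid relations from indices 0 and 1 to all
    integers.\<close>
  have "P.braided (t i) (?g (S j))" if "j \<in> {1, 2, 3}" for i j
  proof -
    have "P.braided (t 0) (?g (S j))" "P.braided (t 1) (?g (S j))"
      using R_iff(1) that unfolding P.satisfies_TS_iff[OF n g] chain_t by auto
    then show ?thesis
      using P.chain_braided_iff[OF chain_t(1), of "?g (S j)"] gS[of j] R_iff(2) that n by auto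
  qed
  moreover have "t i \<otimes>\<^bsub>P\<^esub> ?g (S j) = ?g (S j) \<otimes>\<^bsub>P\<^esub> t i" if "4 \<le> j" "j \<le> n" for i j
    by (rule P.chain_commute[OF chain_t(1)])
      (use that R_iff(1) gS in \<open>auto simp: P.satisfies_TS_iff[OF n g] chain_t\<close>)
  ultimately have "satisfies P f (TS_relations n UNIV)"
    using P.satisfies_TS_iff[OF n f] by simp
  moreover have "satisfies P f (S_relations n)"
    using R_iff(3) satisfies_S_relations_cong[of f ?g P n] by simp
  ultimately have "satisfies P f (elliptic_relations' n)"
    using P.satisfies_elliptic'_iff[OF f] chain_t(1) by simp
  \<comment> \<open>Each \<open>t i\<close> is conjugate to \<open>t 0\<close> or
    \<open>t 1\<close>, hence again squares to the identity.\<close>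
  moreover have "satisfies P f (quadratic_relations n UNIV)" if "K = UNIV"
  proof -
    have "satisfies P ?g (quadratic_relations n {0, 1})"
      using R that by (simp add: R_def)
    then show ?thesis
      unfolding P.satisfies_quadratic_iff[OF g] P.satisfies_quadratic_iff[OF f]
      using P.chain_involution[OF chain_t(1)] by (simp add: chain_t)
  qed
  ultimately have fQ: "satisfies P f Q"
    using K by (auto simp: Q_def satisfies_def)

  \<comment> \<open>Conversely, the generators of \<open>P'\<close> are checked against
    \<open>R\<close>. Only (P3) needs an argument; it is recovered from the braid relations of the
    infinite family.\<close>
  have Q_iff: "satisfies P' ?g' (TS_relations n UNIV)" "P'.chain (\<lambda>i. ?g' (T i))"
    "satisfies P' ?g' (S_relations n)"
    using Q P'.satisfies_elliptic'_iff[OF g'] by (simp_all add: Q_def)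
  have g'S: "?g' (S j) \<in> carrier P'" if "j \<in> {1..n}" for j
    using g' that by (auto simp: generators_def)
  have br': "P'.braided (?g' (T i)) (?g' (S j))" if "j \<in> {1, 2, 3}" for i j
    using Q_iff(1) that unfolding P'.satisfies_TS_iff[OF n g'] by auto
  define c' where "c' = ?g' (T 1) \<otimes>\<^bsub>P'\<^esub> ?g' (T 0)"
  have "?g' (S j) \<otimes>\<^bsub>P'\<^esub> c' \<otimes>\<^bsub>P'\<^esub> (?g' (S j) \<otimes>\<^bsub>P'\<^esub> c')
      = c' \<otimes>\<^bsub>P'\<^esub> ?g' (S j) \<otimes>\<^bsub>P'\<^esub> (c' \<otimes>\<^bsub>P'\<^esub> ?g' (S j))"
    if "j \<in> {1, 2, 3}" for j
  proof -
    have "?g' (S j) \<in> carrier P'"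
      using that n by (intro g'S) auto
    then show ?thesis
      using br' that P'.chain_braided_iff[OF Q_iff(2)] unfolding c'_def by blast
  qed
  moreover have "satisfies P' ?g' (TS_relations n {0, 1})"
    using Q_iff(1) unfolding P'.satisfies_TS_iff[OF n g'] P'.satisfies_TS_iff[OF n g'X] by auto
  ultimately have "satisfies P' ?g' (elliptic_relations n)"
    unfolding P'.satisfies_elliptic_iff[OF n g'X] c'_def using Q_iff(3) by blast
  moreover have "satisfies P' ?g' (quadratic_relations n {0, 1})" if "K = UNIV"
  proof -
    have "satisfies P' ?g' (quadratic_relations n UNIV)"
      using Q that by (simp add: Q_def)
    then show ?thesis
      unfolding P'.satisfies_quadratic_iff[OF g'] P'.satisfies_quadratic_iff[OF g'X] by auto
  qed
  ultimately have g'R: "satisfies P' ?g' R"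
    using K by (auto simp: R_def satisfies_def)

  have "P \<cong> P'"
  proof (rule presented_group_iso_extend[of X Y f R Q, folded P_def P'_def])
    show "f \<in> Y \<rightarrow> carrier P"
      using f by (simp add: Y_def)
    show "f x = ?g x" if "x \<in> X" for x
      using that by (auto simp: X_def generators_def chain_t)
    have TX: "T 0 \<in> X" "T 1 \<in> X"
      by (simp_all add: X_def generators_def)
    have SX: "S j \<in> X" if "j \<in> {1..n}" for j
      using that by (simp add: X_def generators_def)
    fix h y
    assume h: "h \<in> hom P P'" "\<And>x. x \<in> X \<Longrightarrow> h (?g x) = ?g' x" and y: "y \<in> Y"
    \<comment> \<open>Both \<open>h \<circ> t\<close> and the family of generators
      \<open>T i\<close> of \<open>P'\<close> are chains with the same terms at 0 and 1, so they
      coincide; this is the remaining condition that \<open>h\<close> inverts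
      \<open>f\<close>.\<close>
    have "P'.chain (h \<circ> t)"
      by (rule hom_chain[OF P.is_group P'.is_group h(1) chain_t(1)])
    then have "(h \<circ> t) i = ?g' (T i)" for i
      by (rule P'.chain_unique[OF _ Q_iff(2)]) (simp_all add: chain_t h(2) TX)
    then show "h (f y) = ?g' y"
      using y h(2) SX by (auto simp: Y_def generators_def)
  qed (fact XY fQ g'R)+
  then show ?thesis
    by (simp add: P_def P'_def X_def Y_def R_def Q_def)
qed

theorem proposition3p8:
  fixes n :: nat
  assumes "n \<in> {6, 7, 8}"
  shows "elliptic_Artin n \<cong> elliptic_Artin' n \<and>
    presented_group (generators n UNIV) (elliptic_relations' n \<union> quadratic_relations n UNIV)
      \<cong> hyperbolic_elliptic_Weyl n"
proof
  have n: "3 \<le> n" using assms by auto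
  show "elliptic_Artin n \<cong> elliptic_Artin' n"
    using elliptic_presentations_iso[OF n, of "{}"]
    by (simp add: elliptic_Artin_def elliptic_Artin'_def)
  show "presented_group (generators n UNIV) (elliptic_relations' n \<union> quadratic_relations n UNIV)
      \<cong> hyperbolic_elliptic_Weyl n"
    \<comment> \<open>The case \<open>K = UNIV\<close> yields the isomorphism starting at the Weyl
      group, so it is reversed.\<close>
    using group.iso_sym[OF group_presented_group elliptic_presentations_iso[OF n, of UNIV]]
    by (simp add: hyperbolic_elliptic_Weyl_def)
qed

end
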